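(* Let $\kappa$ be an infinite regular cardinal, let $\mu=\mathrm{cof}(2^\kappa)$, and let $\lambda$ be a cardinal with $\kappa\leq\lambda\leq\mu$ and $\lambda^{<\kappa}\leq\mu$. If $\mathfrak{r}(\kappa,\lambda)=2^\kappa$, then there is a $\kappa$-barely independent family over $\mu$ of size $\lambda$.
   Context: Notation: for a set $X$ and $A\subseteq X$, put $A^0=A$ and $A^1=X\setminus A$. For a family $\mathcal{A}$ of subsets of $X$ and $h:\mathcal{A}\to 2=\{0,1\}$, put $\mathcal{A}^h=\{A^{h(A)} : A\in\mathcal{A}\}$. The intersection of the empty family of subsets of $X$ is $X$. For a cardinal $\nu$, $[X]^{\nu}$ (resp. $[X]^{<\nu}$) is the set of subsets of $X$ of cardinality $\nu$ (resp. less than $\nu$). Definition: let $\kappa\leq\mu$ be infinite cardinals and let $\mathcal{I}\subseteq[\mu]^{\mu}$. The family $\mathcal{I}$ is called $\kappa$-barely independent over $\mu$ if $|\mathcal{I}|\geq\kappa$ and (i) $|\bigcap\mathcal{A}^h|=\mu$ for every $\mathcal{A}\in[\mathcal{I}]^{<\kappa}$ and every $h:\mathcal{A}\to 2$; (ii) $|\bigcap\mathcal{A}^h|<\mu$ for every $\mathcal{A}\in[\mathcal{I}]^{\kappa}$ and every $h:\mathcal{A}\to 2$. For infinite sets $R,S$, $S$ splits $R$ if both $R\cap S$ and $R\setminus S$ are infinite; otherwise $R$ reaps $S$. For infinite cardinals $\kappa\leq\lambda$, $\mathfrak{r}(\kappa,\lambda)$ is the minimum size of a family $\mathcal{R}\subseteq[\lambda]^{\kappa}$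 such that every infinite $S\subseteq\lambda$ is reaped by at least one member of $\mathcal{R}$. *)

theory Defs
  imports Main
begin

unbundle cardinal_syntax

text \<open>
  A cardinal is a relation \<open>r\<close> with \<open>Card_order r\<close>, its underlying set (the ordinal itself) is
  \<open>Field r\<close>, and cardinals living on different types are compared by \<open>\<le>o\<close>, \<open><o\<close> and \<open>=o\<close>.
\<close>

text \<open>Only meaningful for nonempty \<open>\<A>\<close>; see \<open>min_card_attained\<close> below.\<close>

definition min_card :: "'a set set \<Rightarrow> 'a rel" where
  "min_card \<A> = card_of (SOME A. A \<in> \<A> \<and> (\<forall>B\<in>\<A>. |A| \<le>o |B| ))"

definition sets_of_card :: "'a set \<Rightarrow> 'b rel \<Rightarrow> 'a set set" where
  "sets_of_card X \<nu> = {A. A \<subseteq> X \<and> |A| =o \<nu>}"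

definition sets_of_card_less :: "'a set \<Rightarrow> 'b rel \<Rightarrow> 'a set set" where
  "sets_of_card_less X \<nu> = {A. A \<subseteq> X \<and> |A| <o \<nu>}"

text \<open>
  The library's \<^const>\<open>cofinal\<close> asks for strictly larger elements, which
  for infinite cardinals (limit ordinals) is the same as being unbounded.
\<close>

definition cofinality :: "'a rel \<Rightarrow> 'a rel" where
  "cofinality r = min_card {K. K \<subseteq> Field r \<and> cofinal K r}"

text \<open>
  \<open>\<lambda>\<^bsup><\<kappa>\<^esup>\<close> as the number of sequences in \<open>\<lambda>\<close> indexed by an ordinal \<open>\<alpha> < \<kappa>\<close>, where \<open>\<alpha>\<close> is encoded
  as the initial segment \<open>underS \<kappa> a\<close>. By \<open>cexp_less_ordLeq_iff\<close> below it is the supremum of the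
  \<open>\<lambda>\<^bsup>\<nu>\<^esup>\<close> for cardinals \<open>\<nu> < \<kappa>\<close>.
\<close>

definition cexp_less :: "'l rel \<Rightarrow> 'k rel \<Rightarrow> ('k \<times> ('k \<Rightarrow> 'l)) rel" where
  "cexp_less lam \<kappa> = |SIGMA a : Field \<kappa>. Func (underS \<kappa> a) (Field lam)|"

definition splits :: "'a set \<Rightarrow> 'a set \<Rightarrow> bool" where
  "splits S R \<longleftrightarrow> infinite (R \<inter> S) \<and> infinite (R - S)"

definition reaps :: "'a set \<Rightarrow> 'a set \<Rightarrow> bool" where
  "reaps R S \<longleftrightarrow> \<not> splits S R"

definition reaping_number :: "'k rel \<Rightarrow> 'l rel \<Rightarrow> 'l set rel" where
  "reaping_number \<kappa> lam =
     min_card {\<R>. \<R> \<subseteq> sets_of_card (Field lam) \<kappa> \<and>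
                   (\<forall>S. S \<subseteq> Field lam \<and> infinite S \<longrightarrow> (\<exists>R\<in>\<R>. reaps R S))}"

text \<open>\<open>False\<close> and \<open>True\<close> play the roles of \<open>0\<close> and \<open>1\<close>.\<close>

definition side :: "'a set \<Rightarrow> 'a set \<Rightarrow> bool \<Rightarrow> 'a set" where
  "side X A i = (if i then X - A else A)"

text \<open>
  The intersection of \<open>\<A>\<^bsup>h\<^esup>\<close> inside \<open>X\<close>; intersecting with \<open>X\<close> only matters for \<open>\<A> = {}\<close>, where the
  result has to be \<open>X\<close>. Only the values of \<open>h\<close> on \<open>\<A>\<close> are used.
\<close>

definition Inter_sides :: "'a set \<Rightarrow> 'a set set \<Rightarrow> ('a set \<Rightarrow> bool) \<Rightarrow> 'a set" where
  "Inter_sides X \<A> h = X \<inter> \<Inter> ((\<lambda>A. side X A (h A)) ` \<A>)"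

definition barely_independent :: "'k rel \<Rightarrow> 'm rel \<Rightarrow> 'm set set \<Rightarrow> bool" where
  "barely_independent \<kappa> \<mu> \<I> \<longleftrightarrow>
     Cinfinite \<kappa> \<and> Cinfinite \<mu> \<and> \<kappa> \<le>o \<mu> \<and>
     \<I> \<subseteq> sets_of_card (Field \<mu>) \<mu> \<and> \<kappa> \<le>o |\<I>| \<and>
     (\<forall>\<A> \<in> sets_of_card_less \<I> \<kappa>. \<forall>h. |Inter_sides (Field \<mu>) \<A> h| =o \<mu>) \<and>
     (\<forall>\<A> \<in> sets_of_card \<I> \<kappa>. \<forall>h. |Inter_sides (Field \<mu>) \<A> h| <o \<mu>)"


lemma min_card_attained:
  assumes "\<A> \<noteq> {}"
  obtains A where "A \<in> \<A>" "min_card \<A> = |A|" "\<And>B. B \<in> \<A> \<Longrightarrow> |A| \<le>o |B|"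
proof -
  have "\<exists>r \<in> card_of ` \<A>. \<forall>r' \<in> card_of ` \<A>. r \<le>o r'"
    by (rule exists_minim_Card_order) (use assms in \<open>auto simp: card_of_Card_order\<close>)
  then have "\<exists>A. A \<in> \<A> \<and> (\<forall>B\<in>\<A>. |A| \<le>o |B| )"
    by blast
  from someI_ex[OF this] show thesis
    using that unfolding min_card_def by blast
qed

lemma cofinality_attained:
  assumes "Cinfinite r"
  obtains K where "K \<subseteq> Field r" "cofinal K r" "cofinality r = |K|"
    "\<And>L. L \<subseteq> Field r \<Longrightarrow> cofinal L r \<Longrightarrow> |K| \<le>o |L|"
proof -
  have "Field r \<in> {K. K \<subseteq> Field r \<and> cofinal K r}"
    using assms infinite_Card_order_limit
    by (fastforce simp: cofinal_def cinfinite_def)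
  then have "{K. K \<subseteq> Field r \<and> cofinal K r} \<noteq> {}"
    by blast
  from min_card_attained[OF this] show thesis
    using that unfolding cofinality_def by (metis (mono_tags, lifting) mem_Collect_eq)
qed

lemma reaping_family_exists:
  assumes k: "Cinfinite \<kappa>" and l: "Card_order lam" and kl: "\<kappa> \<le>o lam"
    and S: "S \<subseteq> Field lam" "infinite S"
  shows "\<exists>R \<in> sets_of_card (Field lam) \<kappa>. reaps R S"
proof -
  have sub: "\<exists>R. R \<subseteq> T \<and> |R| =o \<kappa>" if T: "\<kappa> \<le>o |T|" for T :: "'b set"
  proof -
    have "|Field \<kappa>| =o \<kappa>" using k card_of_Field_ordIso by blast
    then have "|Field \<kappa>| \<le>o |T|" using T ordIso_ordLeq_trans by blast
    then obtain f where f: "inj_on f (Field \<kappa>)" "f ` Field \<kappa> \<subseteq> T"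
      using card_of_ordLeq by metis
    have "|Field \<kappa>| =o |f ` Field \<kappa>|"
      using f(1) card_of_ordIsoI inj_on_imp_bij_betw by blast
    then show ?thesis
      using f(2) ordIso_transitive[OF ordIso_symmetric \<open>|Field \<kappa>| =o \<kappa>\<close>] by blast
  qed
  show ?thesis
  proof (cases "\<kappa> \<le>o |S|")
    case True
    then obtain R where R: "R \<subseteq> S" "|R| =o \<kappa>" using sub by blast
    then have "reaps R S" unfolding reaps_def splits_def by (simp add: Diff_eq_empty_iff[THEN iffD2])
    then show ?thesis using R S unfolding sets_of_card_def by blast
  next
    case False
    have inf: "infinite (Field lam)" using S finite_subset by blast
    have lF: "|Field lam| =o lam" using l card_of_Field_ordIso by blast
    have "Well_order \<kappa>" using k unfolding card_order_on_def by simp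
    then have "|S| <o \<kappa>"
      using False not_ordLeq_iff_ordLess[OF card_of_Well_order, of \<kappa> S] by simp
    then have "|S| <o |Field lam|"
      using kl lF ordLess_ordLeq_trans ordIso_symmetric ordLess_ordIso_trans by blast
    moreover have "S \<union> (Field lam - S) = Field lam" using S by blast
    ultimately have "\<not> |Field lam - S| <o |Field lam|"
      using inf card_of_Un_ordLess_infinite[of "Field lam" S "Field lam - S"]
        ordLess_irreflexive by metis
    then have "|Field lam| \<le>o |Field lam - S|"
      by (rule not_ordLess_iff_ordLeq[OF card_of_Well_order card_of_Well_order, THEN iffD1])
    then have "\<kappa> \<le>o |Field lam - S|"
      using ordLeq_transitive[OF ordLeq_ordIso_trans[OF kl ordIso_symmetric[OF lF]]] by blast
    then obtain R where R: "R \<subseteq> Field lam - S" "|R| =o \<kappa>" using sub by blast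
    then have "R \<inter> S = {}" by blast
    then have "reaps R S" unfolding reaps_def splits_def by simp
    then show ?thesis using R unfolding sets_of_card_def by blast
  qed
qed

lemma cexp_less_ordLeq_iff:
  fixes \<kappa> :: "'k rel" and lam :: "'l rel" and \<mu> :: "'m rel"
  assumes k: "Cinfinite \<kappa>" and l: "Card_order lam" and kl: "\<kappa> \<le>o lam" and m: "Card_order \<mu>"
  shows "cexp_less lam \<kappa> \<le>o \<mu> \<longleftrightarrow>
         (\<forall>\<nu> :: 'k rel. Card_order \<nu> \<and> \<nu> <o \<kappa> \<longrightarrow> lam ^c \<nu> \<le>o \<mu>)"
  (is "?L \<longleftrightarrow> ?R")
proof
  assume L: ?L
  show ?R
  proof (intro allI impI)
    fix \<nu> :: "'k rel" assume n: "Card_order \<nu> \<and> \<nu> <o \<kappa>"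
    have wk: "Well_order \<kappa>" and wn: "Well_order \<nu>"
      using k n unfolding card_order_on_def by auto
    obtain a where a: "a \<in> Field \<kappa>" "\<nu> =o Restr \<kappa> (underS \<kappa> a)"
      using n ordLess_iff_ordIso_Restr[OF wk wn] by blast
    have "Field (Restr \<kappa> (underS \<kappa> a)) = underS \<kappa> a"
      by (simp add: wk Field_Restr_ofilter wo_rel.underS_ofilter wo_rel_def)
    then have "|Field \<nu>| =o |underS \<kappa> a|"
      using card_of_cong[OF a(2)] by simp
    then have "\<nu> =o |underS \<kappa> a|"
      using n card_of_Field_ordIso ordIso_symmetric ordIso_transitive by blast
    then have "lam ^c \<nu> =o lam ^c |underS \<kappa> a|"
      using n l cexp_cong2 by blast
    moreover have "lam ^c |underS \<kappa> a| \<le>o cexp_less lam \<kappa>"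
      unfolding cexp_def cexp_less_def Field_card_of
      by (rule card_of_ordLeqI[of "Pair a"]) (use a in \<open>auto simp: inj_on_def\<close>)
    ultimately show "lam ^c \<nu> \<le>o \<mu>"
      using L ordIso_ordLeq_trans ordLeq_transitive by blast
  qed
next
  assume R: ?R
  have each: "|Func (underS \<kappa> a) (Field lam)| \<le>o \<mu>" if "a \<in> Field \<kappa>" for a
  proof -
    have "|underS \<kappa> a| <o \<kappa>" using card_of_underS[of \<kappa> a] k that by simp
    then have "lam ^c |underS \<kappa> a| \<le>o \<mu>" using R card_of_Card_order[of "underS \<kappa> a"] by blast
    then show ?thesis unfolding cexp_def Field_card_of .
  qed
  have inf: "infinite (Field \<kappa>)" using k unfolding cinfinite_def by blast
  then obtain x where "x \<in> Field \<kappa>" using infinite_imp_nonempty by blast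
  have "|{x}| <o \<kappa>"
    
    using finite_ordLess_infinite[OF card_of_Well_order, of \<kappa> "{x}"] k inf
    by (simp add: Field_card_of card_order_on_def)
  then have "lam ^c |{x}| \<le>o \<mu>" using R card_of_Card_order[of "{x}"] by blast
  moreover have "|Field lam| \<le>o lam ^c |{x}|"
    unfolding cexp_def Field_card_of
    by (rule card_of_ordLeqI[of "\<lambda>y z. if z = x then y else undefined"])
       (auto simp: Func_def inj_on_def dest: fun_cong[of _ _ x])
  ultimately have lm: "lam \<le>o \<mu>"
    using ordIso_ordLeq_trans[OF ordIso_symmetric[OF card_of_Field_ordIso[OF l]]] ordLeq_transitive
    by blast
  have km: "\<kappa> \<le>o \<mu>" by (rule ordLeq_transitive[OF kl lm])
  then have "|Field \<kappa>| \<le>o \<mu>" using k card_of_Field_ordIso ordIso_ordLeq_trans[OF _ km] by blast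
  moreover have "infinite (Field \<mu>)"
    using cinfinite_mono[OF km] inf unfolding cinfinite_def by simp
  ultimately show ?L
    unfolding cexp_less_def
    by (intro card_of_Sigma_ordLeq_infinite_Field) (auto simp: m each)
qed

end

theory Submission
  imports Defs
begin

text \<open>
  Exhaust \<open>[\<lambda>]\<^sup>\<kappa>\<close> (of size at most \<open>2\<^sup>\<kappa>\<close>) by \<open>\<mu> = cof(2\<^sup>\<kappa>)\<close> many increasing layers \<open>L\<^sub>\<alpha>\<close> of size \<open>< 2\<^sup>\<kappa>\<close>, and
  enumerate the pairs \<open>G \<subseteq> F\<close> with \<open>F \<in> [\<lambda>]\<^bsup><\<kappa>\<^esup>\<close> along \<open>\<mu>\<close>, each \<open>\<mu>\<close> times. As \<open>r(\<kappa>,\<lambda>) = 2\<^sup>\<kappa>\<close>, some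
  \<open>S\<^sub>\<alpha>\<close> splits \<open>R - F\<^sub>\<alpha>\<close> for all \<open>R \<in> L\<^sub>\<alpha>\<close>, so \<open>T\<^sub>\<alpha> = (S\<^sub>\<alpha> - F\<^sub>\<alpha>) \<union> G\<^sub>\<alpha>\<close> still splits every
  \<open>R \<in> L\<^sub>\<alpha>\<close> and has trace \<open>G\<^sub>\<alpha>\<close> on \<open>F\<^sub>\<alpha>\<close>. The sets \<open>A\<^sub>x = {\<alpha>. x \<in> T\<^sub>\<alpha>}\<close> form the family: small patterns
  are realised \<open>\<mu>\<close> times, whereas a pattern of size \<open>\<kappa>\<close> is constant on some \<open>R\<close> of size \<open>\<kappa>\<close>, which
  is impossible once \<open>R \<in> L\<^sub>\<alpha>\<close>.
\<close>

section \<open>Layers and enumerations indexed by \<open>\<mu>\<close>\<close>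

text \<open>Place \<open>X\<close> injectively into \<open>r\<close> and let a cofinal set
  \<open>K\<close> of minimal size, enumerated by \<open>e\<close> along \<open>\<mu>\<close>, bound
  the layers. An initial part of the enumeration has fewer than |\<open>K\<close>| values, so it is
  not cofinal and its layer is bounded in \<open>r\<close>. Each point lies below some
  \<open>e \<beta>\<close> and so belongs to every layer from \<beta> on.\<close>

lemma filtration_cofinality:
  fixes r :: "'r rel" and \<mu> :: "'m rel" and X :: "'x set"
  assumes r: "Cinfinite r" and m: "Cinfinite \<mu>" and mr: "\<mu> =o cofinality r" and X: "|X| \<le>o r"
  obtains L :: "'m \<Rightarrow> 'x set" where
    "\<And>\<alpha>. \<alpha> \<in> Field \<mu> \<Longrightarrow> L \<alpha> \<subseteq> X"
    "\<And>\<alpha>. \<alpha> \<in> Field \<mu> \<Longrightarrow> |L \<alpha>| <o r"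
    "\<And>x. x \<in> X \<Longrightarrow> |{\<alpha> \<in> Field \<mu>. x \<notin> L \<alpha>}| <o \<mu>"
proof -
  have wr: "wo_rel r" and wm: "wo_rel \<mu>"
    using r m by (auto simp: wo_rel_def card_order_on_def)
  \<comment> \<open>An infinite cardinal has no last element, so the closed segment of
    \<open>a\<close> fits into the open segment of some larger \<open>b\<close>, which is small
    because \<nu> is an initial ordinal.\<close>
  have below: "|under \<nu> a| <o \<nu>" if n: "Cinfinite \<nu>" "a \<in> Field \<nu>" for a and \<nu> :: "'z rel"
  proof -
    obtain b where b: "b \<in> Field \<nu>" "a \<noteq> b" "(a, b) \<in> \<nu>"
      using infinite_Card_order_limit[of \<nu> a] n unfolding cinfinite_def by blast
    have "wo_rel \<nu>" using n by (auto simp: wo_rel_def card_order_on_def)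
    then have "trans \<nu>" "antisym \<nu>" by (auto intro: wo_rel.TRANS wo_rel.ANTISYM)
    then have "under \<nu> a \<subseteq> underS \<nu> b"
      using b by (auto simp: under_def underS_def dest: transD antisymD)
    then have "|under \<nu> a| \<le>o |underS \<nu> b|" by (rule card_of_mono1)
    then show ?thesis using card_of_underS[of \<nu> b] n b ordLeq_ordLess_trans by blast
  qed
  obtain K where K: "K \<subseteq> Field r" "cofinal K r" "cofinality r = |K|"
    "\<And>L. L \<subseteq> Field r \<Longrightarrow> cofinal L r \<Longrightarrow> |K| \<le>o |L|"
    using cofinality_attained[OF r] by metis
  have "|Field \<mu>| =o |K|"
    using m mr K(3) card_of_Field_ordIso ordIso_transitive by metis
  then obtain e where e: "bij_betw e (Field \<mu>) K"
    using card_of_ordIso by blast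
  have "|X| \<le>o |Field r|"
    using X r card_of_Field_ordIso ordIso_symmetric ordLeq_ordIso_trans by blast
  then obtain f where f: "inj_on f X" "f ` X \<subseteq> Field r"
    using card_of_ordLeq by metis
  \<comment> \<open>The enumeration \<open>e\<close> need not be monotone. Collecting all \<beta> up
    to \<alpha> makes the layers increase.\<close>
  define L where "L \<alpha> = {x \<in> X. \<exists>\<beta>\<in>under \<mu> \<alpha>. (f x, e \<beta>) \<in> r}" for \<alpha>
  show thesis
  proof
    fix \<alpha> assume a: "\<alpha> \<in> Field \<mu>"
    show "L \<alpha> \<subseteq> X" by (auto simp: L_def)
    have uF: "under \<mu> \<alpha> \<subseteq> Field \<mu>" by (auto simp: under_def Field_def)
    let ?E = "e ` under \<mu> \<alpha>"
    have EK: "?E \<subseteq> Field r"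
      using uF e K(1) by (auto simp: bij_betw_def)
    have "|?E| <o |K|"
      using below[OF m a] card_of_image ordLeq_ordLess_trans ordLess_ordIso_trans mr K(3) by metis
    then have "\<not> cofinal ?E r"
      using K(4)[OF EK] not_ordLess_ordLeq by blast
    \<comment> \<open>Failure of cofinality yields a point that no element of \<open>?E\<close>
      strictly exceeds; by totality it is an upper bound of \<open>?E\<close>.\<close>
    then obtain c where c: "c \<in> Field r" "\<And>b. b \<in> ?E \<Longrightarrow> c = b \<or> (c, b) \<notin> r"
      by (auto simp: cofinal_def)
    have c': "(b, c) \<in> r" if "b \<in> ?E" for b
      using c(2)[OF that] wo_rel.TOTALS[OF wr] c(1) that EK by blast
    have "f ` L \<alpha> \<subseteq> under r c"
      using c' wo_rel.TRANS[OF wr] by (auto simp: L_def under_def dest: transD)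
    moreover have "inj_on f (L \<alpha>)"
      using f(1) by (rule inj_on_subset) (auto simp: L_def)
    ultimately have "|L \<alpha>| \<le>o |under r c|"
      by (auto intro: card_of_ordLeqI)
    then show "|L \<alpha>| <o r"
      using below[OF r c(1)] ordLeq_ordLess_trans by blast
  next
    fix x assume x: "x \<in> X"
    then obtain k where k: "k \<in> K" "(f x, k) \<in> r"
      using f(2) K(2) unfolding cofinal_def by blast
    then obtain \<beta> where b: "\<beta> \<in> Field \<mu>" "k = e \<beta>"
      using e by (auto simp: bij_betw_def)
    have "{\<alpha> \<in> Field \<mu>. x \<notin> L \<alpha>} \<subseteq> under \<mu> \<beta>"
    proof
      fix \<alpha> assume "\<alpha> \<in> {\<alpha> \<in> Field \<mu>. x \<notin> L \<alpha>}"
      then have "\<alpha> \<in> Field \<mu>" "(\<beta>, \<alpha>) \<notin> \<mu>"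
        using k b x by (auto simp: L_def under_def)
      then show "\<alpha> \<in> under \<mu> \<beta>"
        using wo_rel.TOTALS[OF wm] b by (auto simp: under_def)
    qed
    then have "|{\<alpha> \<in> Field \<mu>. x \<notin> L \<alpha>}| \<le>o |under \<mu> \<beta>|" by (rule card_of_mono1)
    then show "|{\<alpha> \<in> Field \<mu>. x \<notin> L \<alpha>}| <o \<mu>"
      using below[OF m b(1)] ordLeq_ordLess_trans by blast
  qed
qed

text \<open>Compose a surjection of \<open>Field \<mu>\<close> onto \<open>P\<close> with the first
  coordinate of a bijection from \<open>Field \<mu>\<close> to its square. On each fibre the second
  coordinate still takes every value in \<open>Field \<mu>\<close>, which makes the fibre
  large.\<close>

lemma enumeration_with_large_fibres:
  fixes \<mu> :: "'m rel" and P :: "'p set"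
  assumes m: "Cinfinite \<mu>" and P: "|P| \<le>o \<mu>" "P \<noteq> {}"
  obtains p :: "'m \<Rightarrow> 'p" where
    "\<And>\<alpha>. \<alpha> \<in> Field \<mu> \<Longrightarrow> p \<alpha> \<in> P"
    "\<And>x. x \<in> P \<Longrightarrow> |{\<alpha> \<in> Field \<mu>. p \<alpha> = x}| =o \<mu>"
proof -
  have F: "|Field \<mu>| =o \<mu>" using m card_of_Field_ordIso by blast
  have inf: "infinite (Field \<mu>)" using m by (auto simp: cinfinite_def)
  have "|P| \<le>o |Field \<mu>|"
    using P F ordIso_symmetric ordLeq_ordIso_trans by blast
  then obtain g where g: "g ` Field \<mu> = P"
    using card_of_ordLeq2[OF P(2)] by metis
  have "|Field \<mu>| =o |Field \<mu> \<times> Field \<mu>|"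
    using card_of_Times_same_infinite[OF inf] ordIso_symmetric by blast
  then obtain q where q: "bij_betw q (Field \<mu>) (Field \<mu> \<times> Field \<mu>)"
    using card_of_ordIso by blast
  show thesis
  proof
    show "(g \<circ> fst \<circ> q) \<alpha> \<in> P" if "\<alpha> \<in> Field \<mu>" for \<alpha>
      using bij_betwE[OF q] that g by (auto simp: mem_Times_iff)
  next
    fix x assume "x \<in> P"
    then obtain y where y: "y \<in> Field \<mu>" "g y = x" using g by blast
    let ?D = "{\<alpha> \<in> Field \<mu>. (g \<circ> fst \<circ> q) \<alpha> = x}"
    have "Field \<mu> \<subseteq> (snd \<circ> q) ` ?D"
    proof
      fix z assume z: "z \<in> Field \<mu>"
      then obtain \<alpha> where "\<alpha> \<in> Field \<mu>" "q \<alpha> = (y, z)"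
        using q y bij_betw_imp_surj_on[OF q] by (metis SigmaI imageE)
      then show "z \<in> (snd \<circ> q) ` ?D" using y by (intro image_eqI[of _ _ \<alpha>]) auto
    qed
    then have "|Field \<mu>| \<le>o |?D|"
      by (rule ordLeq_transitive[OF card_of_mono1 card_of_image])
    moreover have "|?D| \<le>o |Field \<mu>|" by (rule card_of_mono1) auto
    ultimately have "|?D| =o |Field \<mu>|" using ordIso_iff_ordLeq by blast
    then show "|?D| =o \<mu>" using F ordIso_transitive by blast
  qed
qed

section \<open>Counting subsets by functions\<close>

lemma image_of_Func:
  assumes "|D| =o |F|" and "F \<subseteq> B"
  shows "\<exists>g \<in> Func D B. g ` D = F"
proof -
  obtain g where "bij_betw g D F" using assms(1) card_of_ordIso by blast
  \<comment> \<open>\<open>Func\<close> requires the value \<open>undefined\<close> outside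
    \<open>D\<close>.\<close>
  then have "(\<lambda>x. if x \<in> D then g x else undefined) \<in> Func D B"
    "(\<lambda>x. if x \<in> D then g x else undefined) ` D = F"
    using assms(2) by (auto simp: Func_def bij_betw_def)
  then show ?thesis by blast
qed

text \<open>A set smaller than \<kappa> is equinumerous with a proper initial segment of \<kappa>,
  hence is the range of one of the sequences that \<open>cexp_less\<close> counts.\<close>

lemma card_sets_of_card_less:
  assumes "Card_order \<kappa>"
  shows "|sets_of_card_less (Field lam) \<kappa>| \<le>o cexp_less lam \<kappa>"
proof -
  have wk: "Well_order \<kappa>" using assms by (simp add: card_order_on_def)
  have "sets_of_card_less (Field lam) \<kappa> \<subseteq>
    (\<lambda>(a, g). g ` underS \<kappa> a) ` (SIGMA a : Field \<kappa>. Func (underS \<kappa> a) (Field lam))"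
  proof
    fix F assume "F \<in> sets_of_card_less (Field lam) \<kappa>"
    then have F: "F \<subseteq> Field lam" "|F| <o \<kappa>" by (auto simp: sets_of_card_less_def)
    obtain a where a: "a \<in> Field \<kappa>" "|F| =o Restr \<kappa> (underS \<kappa> a)"
      using F(2) ordLess_iff_ordIso_Restr[OF wk card_of_Well_order] by blast
    have "Field (Restr \<kappa> (underS \<kappa> a)) = underS \<kappa> a"
      by (simp add: wk Field_Restr_ofilter wo_rel.underS_ofilter wo_rel_def)
    then have "|F| =o |underS \<kappa> a|"
      using card_of_cong[OF a(2)] by (simp add: Field_card_of)
    then obtain g where "g \<in> Func (underS \<kappa> a) (Field lam)" "g ` underS \<kappa> a = F"
      using image_of_Func F(1) ordIso_symmetric by metis
    then show "F \<in> (\<lambda>(a, g). g ` underS \<kappa> a) ` (SIGMA a : Field \<kappa>. Func (underS \<kappa> a) (Field lam))"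
      using a(1) by (intro image_eqI[of _ _ "(a, g)"]) auto
  qed
  then show ?thesis
    unfolding cexp_less_def by (rule ordLeq_transitive[OF card_of_mono1 card_of_image])
qed

lemma card_sets_of_card:
  assumes "Card_order \<kappa>"
  shows "|sets_of_card (Field lam) \<kappa>| \<le>o lam ^c \<kappa>"
proof -
  have "sets_of_card (Field lam) \<kappa> \<subseteq> (\<lambda>g. g ` Field \<kappa>) ` Func (Field \<kappa>) (Field lam)"
  proof
    fix F assume "F \<in> sets_of_card (Field lam) \<kappa>"
    then have F: "F \<subseteq> Field lam" "|F| =o \<kappa>"
      by (auto simp: sets_of_card_def)
    have "|Field \<kappa>| =o |F|"
      by (rule ordIso_transitive[OF card_of_Field_ordIso[OF assms] ordIso_symmetric[OF F(2)]])
    with F(1) show "F \<in> (\<lambda>g. g ` Field \<kappa>) ` Func (Field \<kappa>) (Field lam)"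
      using image_of_Func[of "Field \<kappa>" F "Field lam"] by blast
  qed
  then show ?thesis
    unfolding cexp_def by (rule ordLeq_transitive[OF card_of_mono1 card_of_image])
qed

section \<open>Splitting, and the passage to barely independent rows\<close>

lemma splitting_set_exists:
  assumes "\<R> \<subseteq> sets_of_card (Field lam) \<kappa>" and "|\<R>| <o reaping_number \<kappa> lam"
  obtains S where "\<And>R. R \<in> \<R> \<Longrightarrow> splits S R"
proof -
  let ?M = "{\<R>. \<R> \<subseteq> sets_of_card (Field lam) \<kappa> \<and>
    (\<forall>S. S \<subseteq> Field lam \<and> infinite S \<longrightarrow> (\<exists>R\<in>\<R>. reaps R S))}"
  have "\<R> \<notin> ?M"
  proof
    assume M: "\<R> \<in> ?M"
    \<comment> \<open>\<open>min_card\<close> is meaningful only for a nonempty collection; here the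
      assumed member \<open>\<R>\<close> provides this.\<close>
    then have "?M \<noteq> {}" by blast
    then obtain B where "B \<in> ?M" and "min_card ?M = |B|" and "\<And>C. C \<in> ?M \<Longrightarrow> |B| \<le>o |C|"
      by (rule min_card_attained) (rule that)
    then have "reaping_number \<kappa> lam \<le>o |\<R>|"
      unfolding reaping_number_def using M by simp
    then show False using assms(2) not_ordLess_ordLeq by blast
  qed
  then show thesis using assms(1) that unfolding reaps_def by blast
qed

text \<open>Otherwise \<open>R\<close> would be covered by two sets smaller than the infinite
  cardinal \<kappa>.\<close>

lemma card_Diff_less:
  assumes k: "Cinfinite \<kappa>" and R: "|R| =o \<kappa>" and F: "|F| <o \<kappa>"
  shows "|R - F| =o \<kappa>"
proof -
  have wk: "Well_order \<kappa>" using k by (simp add: card_order_on_def)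
  have "|R - F| \<le>o \<kappa>"
    using R card_of_mono1[of "R - F" R] ordLeq_ordIso_trans by blast
  moreover have "\<not> |R - F| <o \<kappa>"
  proof
    assume "|R - F| <o \<kappa>"
    then have "|(R - F) \<union> F| <o \<kappa>"
      using card_of_Un_ordLess_infinite_Field[of \<kappa> "R - F" F] k F unfolding cinfinite_def by blast
    then have "|R| <o \<kappa>"
      using card_of_mono1[of R "(R - F) \<union> F"] ordLeq_ordLess_trans by blast
    then show False using R not_ordLess_ordIso by blast
  qed
  then have "\<kappa> \<le>o |R - F|"
    using not_ordLess_iff_ordLeq[OF wk card_of_Well_order] not_ordLess_iff_ordLeq[OF card_of_Well_order wk] by blast
  ultimately show ?thesis
    by (simp add: ordIso_iff_ordLeq)
qed

text \<open>\<open>T \<alpha>\<close> is the splitting set chosen at stage \<open>\<alpha>\<close>; the family consists of the rows of its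
  incidence relation.\<close>

lemma barely_independent_rows:
  fixes \<kappa> :: "'k rel" and \<mu> :: "'m rel" and X :: "'x set" and T :: "'m \<Rightarrow> 'x set"
  assumes k: "Cinfinite \<kappa>" and m: "Cinfinite \<mu>" and km: "\<kappa> \<le>o \<mu>" and kX: "\<kappa> \<le>o |X|"
    and pat: "\<And>F G. F \<in> sets_of_card_less X \<kappa> \<Longrightarrow> G \<subseteq> F \<Longrightarrow>
      \<mu> \<le>o |{\<alpha> \<in> Field \<mu>. T \<alpha> \<inter> F = G}|"
    and spl: "\<And>R. R \<in> sets_of_card X \<kappa> \<Longrightarrow> |{\<alpha> \<in> Field \<mu>. \<not> splits (T \<alpha>) R}| <o \<mu>"
  shows "\<exists>\<I>. barely_independent \<kappa> \<mu> \<I> \<and> |\<I>| =o |X|"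
proof -
  define A where "A x = {\<alpha> \<in> Field \<mu>. x \<in> T \<alpha>}" for x
  have F: "|Field \<mu>| =o \<mu>" using m card_of_Field_ordIso by blast
  have wk: "Well_order \<kappa>" using k by (simp add: card_order_on_def)
  have large: "|D| =o \<mu>" if "D \<subseteq> Field \<mu>" "\<mu> \<le>o |D|" for D
    using ordLeq_ordIso_trans[OF card_of_mono1[OF that(1)] F] that(2) by (simp add: ordIso_iff_ordLeq)
  have fin: "finite B \<Longrightarrow> |B| <o \<kappa>" for B :: "'x set"
    using finite_ordLess_infinite[OF card_of_Well_order wk, of B] k by (simp add: Field_card_of cinfinite_def)
  \<comment> \<open>Some column contains \<open>x\<close> and omits \<open>y\<close>, because the
    pattern {x} on {x, y} is realised; so distinct points have distinct rows.\<close>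
  have inj: "inj_on A X"
  proof (rule inj_onI, rule ccontr)
    fix x y assume xy: "x \<in> X" "y \<in> X" "A x = A y" "x \<noteq> y"
    then have "\<mu> \<le>o |{\<alpha> \<in> Field \<mu>. T \<alpha> \<inter> {x, y} = {x}}|"
      by (intro pat) (auto simp: sets_of_card_less_def fin)
    moreover have "T \<alpha> \<inter> {x, y} \<noteq> {x}" if "\<alpha> \<in> Field \<mu>" for \<alpha>
    proof -
      have "x \<in> T \<alpha> \<longleftrightarrow> y \<in> T \<alpha>" using xy(3) that unfolding A_def by blast
      then show ?thesis using xy(4) by (cases "x \<in> T \<alpha>") auto
    qed
    then have "{\<alpha> \<in> Field \<mu>. T \<alpha> \<inter> {x, y} = {x}} = {}" by simp
    ultimately have "\<mu> \<le>o |{} :: 'm set|" by simp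
    then have "cinfinite |{} :: 'm set|" using m cinfinite_mono[of \<mu> "|{} :: 'm set|"] by simp
    then show False by (simp add: cinfinite_def Field_card_of)
  qed
  have A_large: "|A x| =o \<mu>" if "x \<in> X" for x
  proof (rule large)
    show "A x \<subseteq> Field \<mu>" by (auto simp: A_def)
    have "\<mu> \<le>o |{\<alpha> \<in> Field \<mu>. T \<alpha> \<inter> {x} = {x}}|"
      using that by (intro pat) (auto simp: sets_of_card_less_def fin)
    moreover have "{\<alpha> \<in> Field \<mu>. T \<alpha> \<inter> {x} = {x}} = A x" by (auto simp: A_def)
    ultimately show "\<mu> \<le>o |A x|" by simp
  qed
  have XI: "|A ` X| =o |X|"
    by (rule ordIso_symmetric[OF card_of_ordIsoI[OF inj_on_imp_bij_betw[OF inj]]])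
  \<comment> \<open>Injectivity lets subfamilies of rows be replaced by index sets of the same
    size.\<close>
  have index: "\<exists>E. E \<subseteq> X \<and> \<A> = A ` E \<and> |E| =o |\<A>|" if sub: "\<A> \<subseteq> A ` X" for \<A>
  proof -
    obtain E where E: "E \<subseteq> X" "\<A> = A ` E" using sub by (auto elim: subset_imageE)
    moreover have "|E| =o |A ` E|"
      by (rule card_of_ordIsoI[OF inj_on_imp_bij_betw[OF inj_on_subset[OF inj E(1)]]])
    ultimately show ?thesis by metis
  qed
  \<comment> \<open>Intersecting sides over \<open>E\<close> prescribes the trace of
    \<open>T \<alpha>\<close> on \<open>E\<close>. The negation appears because \<open>True\<close>
    selects the complement.\<close>
  have sides: "Inter_sides (Field \<mu>) (A ` E) h = {\<alpha> \<in> Field \<mu>. \<forall>x\<in>E. x \<in> T \<alpha> \<longleftrightarrow> \<not> h (A x)}" for E h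
    by (auto simp: Inter_sides_def side_def A_def)
  have "barely_independent \<kappa> \<mu> (A ` X)"
    unfolding barely_independent_def
  proof (intro conjI ballI allI km)
    show "cinfinite \<kappa>" "Card_order \<kappa>" "cinfinite \<mu>" "Card_order \<mu>"
      using k m by simp_all
    show "A ` X \<subseteq> sets_of_card (Field \<mu>) \<mu>"
    proof (rule image_subsetI)
      fix x assume "x \<in> X"
      then have "|A x| =o \<mu>" by (rule A_large)
      moreover have "A x \<subseteq> Field \<mu>" by (auto simp: A_def)
      ultimately show "A x \<in> sets_of_card (Field \<mu>) \<mu>" by (simp add: sets_of_card_def)
    qed
    show "\<kappa> \<le>o |A ` X|" by (rule ordLeq_ordIso_trans[OF kX ordIso_symmetric[OF XI]])
  next
    fix \<A> and h :: "'m set \<Rightarrow> bool" assume "\<A> \<in> sets_of_card_less (A ` X) \<kappa>"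
    then have \<A>: "\<A> \<subseteq> A ` X" "|\<A>| <o \<kappa>" by (auto simp: sets_of_card_less_def)
    then obtain E where E: "E \<subseteq> X" "\<A> = A ` E" "|E| =o |\<A>|" using index by metis
    let ?G = "{x \<in> E. \<not> h (A x)}"
    have "E \<in> sets_of_card_less X \<kappa>"
      using E(1) ordIso_ordLess_trans[OF E(3) \<A>(2)] by (simp add: sets_of_card_less_def)
    then have "\<mu> \<le>o |{\<alpha> \<in> Field \<mu>. T \<alpha> \<inter> E = ?G}|" by (rule pat) auto
    moreover have "{\<alpha> \<in> Field \<mu>. T \<alpha> \<inter> E = ?G} = Inter_sides (Field \<mu>) \<A> h"
      unfolding E(2) sides by blast
    ultimately have "\<mu> \<le>o |Inter_sides (Field \<mu>) \<A> h|" by simp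
    moreover have "Inter_sides (Field \<mu>) \<A> h \<subseteq> Field \<mu>"
      unfolding Inter_sides_def by (rule Int_lower1)
    ultimately show "|Inter_sides (Field \<mu>) \<A> h| =o \<mu>" by (intro large)
  next
    fix \<A> and h :: "'m set \<Rightarrow> bool" assume "\<A> \<in> sets_of_card (A ` X) \<kappa>"
    then have \<A>: "\<A> \<subseteq> A ` X" "|\<A>| =o \<kappa>" by (auto simp: sets_of_card_def)
    then obtain E where E: "E \<subseteq> X" "\<A> = A ` E" "|E| =o |\<A>|" using index by metis
    have Ek: "|E| =o \<kappa>" by (rule ordIso_transitive[OF E(3) \<A>(2)])
    \<comment> \<open>The two values of \<open>h\<close> divide \<open>E\<close> into two pieces,
      and at least one has full size \<kappa>.\<close>
    have "\<exists>b. |{x \<in> E. h (A x) = b}| =o \<kappa>"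
    proof (cases "|{x \<in> E. h (A x) = True}| <o \<kappa>")
      case True
      have eq: "E - {x \<in> E. h (A x) = True} = {x \<in> E. h (A x) = False}" by blast
      show ?thesis
        using card_Diff_less[OF k Ek True] unfolding eq by (rule exI)
    next
      case False
      have "|{x \<in> E. h (A x) = True}| \<le>o |E|" by (rule card_of_mono1) auto
      then have "|{x \<in> E. h (A x) = True}| \<le>o \<kappa>" by (rule ordLeq_ordIso_trans[OF _ Ek])
      then have "|{x \<in> E. h (A x) = True}| =o \<kappa>"
        using False unfolding ordLeq_iff_ordLess_or_ordIso by blast
      then show ?thesis by (rule exI)
    qed
    then obtain b where b: "|{x \<in> E. h (A x) = b}| =o \<kappa>" ..
    let ?R = "{x \<in> E. h (A x) = b}"
    have "?R \<in> sets_of_card X \<kappa>" using b E(1) by (auto simp: sets_of_card_def)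
    then have "|{\<alpha> \<in> Field \<mu>. \<not> splits (T \<alpha>) ?R}| <o \<mu>" by (rule spl)
    \<comment> \<open>Since \<open>h\<close> is constant on the rows indexed by \<open>?R\<close>,
      such a \<open>T \<alpha>\<close> contains \<open>?R\<close> or misses it.\<close>
    moreover have "Inter_sides (Field \<mu>) \<A> h \<subseteq> {\<alpha> \<in> Field \<mu>. \<not> splits (T \<alpha>) ?R}"
    proof
      fix \<alpha> assume "\<alpha> \<in> Inter_sides (Field \<mu>) \<A> h"
      then have \<alpha>: "\<alpha> \<in> Field \<mu>" and h: "\<And>x. x \<in> E \<Longrightarrow> x \<in> T \<alpha> \<longleftrightarrow> \<not> h (A x)"
        unfolding E(2) sides by simp_all
      from h have "?R \<inter> T \<alpha> = {} \<or> ?R - T \<alpha> = {}" by (cases b) auto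
      then have "\<not> splits (T \<alpha>) ?R" unfolding splits_def by (metis finite.emptyI)
      with \<alpha> show "\<alpha> \<in> {\<alpha> \<in> Field \<mu>. \<not> splits (T \<alpha>) ?R}" by (intro CollectI conjI)
    qed
    ultimately show "|Inter_sides (Field \<mu>) \<A> h| <o \<mu>"
      by (rule ordLeq_ordLess_trans[OF card_of_mono1, rotated])
  qed
  then show ?thesis using XI by blast
qed

section \<open>Construction of the columns \<open>T \<alpha>\<close>\<close>

theorem theorem4p3:
  fixes \<kappa> :: "'k rel" and \<mu> :: "'m rel" and lam :: "'l rel"
  assumes "Cinfinite \<kappa>" and "regularCard \<kappa>"
    and "Card_order \<mu>" and "\<mu> =o cofinality (ctwo ^c \<kappa>)"
    and "Card_order lam" and "\<kappa> \<le>o lam" and "lam \<le>o \<mu>"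
    and "cexp_less lam \<kappa> \<le>o \<mu>"
    and "reaping_number \<kappa> lam =o ctwo ^c \<kappa>"
  shows "\<exists>\<I>. barely_independent \<kappa> \<mu> \<I> \<and> |\<I>| =o lam"
proof -
  let ?X = "Field lam" and ?c = "ctwo ^c \<kappa>"
  have km: "\<kappa> \<le>o \<mu>" by (rule ordLeq_transitive[OF assms(6,7)])
  have m: "Cinfinite \<mu>" using assms(1,3) cinfinite_mono[OF km] by blast
  have c: "Cinfinite ?c" by (rule Cinfinite_cexp[OF ordLeq_refl[OF Card_order_ctwo] assms(1)])
  have lX: "|?X| =o lam" using assms(5) card_of_Field_ordIso by blast
  have kX: "\<kappa> \<le>o |?X|" by (rule ordLeq_ordIso_trans[OF assms(6) ordIso_symmetric[OF lX]])
  have "\<mu> \<le>o ?c"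
  proof -
    obtain K where K: "K \<subseteq> Field ?c" "cofinality ?c = |K|"
      using cofinality_attained[OF c] by metis
    have "|K| \<le>o ?c"
      using c by (intro ordLeq_ordIso_trans[OF card_of_mono1[OF K(1)] card_of_Field_ordIso]) simp
    then show ?thesis using ordIso_ordLeq_trans[OF assms(4)] K(2) by simp
  qed
  then have "lam \<le>o ?c" by (rule ordLeq_transitive[OF assms(7)])
  \<comment> \<open>From \<mu> \<le> 2^\<kappa> follows \<lambda>^\<kappa> \<le>
    (2^\<kappa>)^\<kappa> = 2^\<kappa>, so the filtration applies to all subsets of
    \<open>?X\<close> of size \<kappa>.\<close>
  then have "lam ^c \<kappa> \<le>o ?c ^c \<kappa>" using assms(1) by (intro cexp_mono1) auto
  also have "?c ^c \<kappa> =o ctwo ^c (\<kappa> *c \<kappa>)" using assms(1) by (intro cexp_cprod) (auto simp: Card_order_ctwo)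
  also have "ctwo ^c (\<kappa> *c \<kappa>) =o ?c"
    using assms(1) by (intro cexp_cong2 cprod_infinite) (auto simp: Card_order_ctwo Card_order_cprod)
  finally have "lam ^c \<kappa> \<le>o ?c" .
  with card_sets_of_card[of \<kappa> lam] assms(1) have "|sets_of_card ?X \<kappa>| \<le>o ?c"
    by (blast intro: ordLeq_transitive[of _ "lam ^c \<kappa>"])
  then obtain L :: "'m \<Rightarrow> 'l set set" where L:
    "\<And>\<alpha>. \<alpha> \<in> Field \<mu> \<Longrightarrow> L \<alpha> \<subseteq> sets_of_card ?X \<kappa>"
    "\<And>\<alpha>. \<alpha> \<in> Field \<mu> \<Longrightarrow> |L \<alpha>| <o ?c"
    "\<And>R. R \<in> sets_of_card ?X \<kappa> \<Longrightarrow> |{\<alpha> \<in> Field \<mu>. R \<notin> L \<alpha>}| <o \<mu>"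
    using filtration_cofinality[OF c m assms(4)] by blast

  let ?Q = "sets_of_card_less ?X \<kappa>"
  \<comment> \<open>A pair (F, G) asks for the trace G on F. As subsets of small sets are small,
    there are at most |\<open>?Q\<close>|^2 \<le> \<mu> such requests.\<close>
  let ?P = "SIGMA F : ?Q. Pow F"
  have Q: "|?Q| \<le>o \<mu>"
    using assms(1) by (intro ordLeq_transitive[OF card_sets_of_card_less assms(8)]) simp
  have Qsub: "G \<in> ?Q" if "F \<in> ?Q" "G \<subseteq> F" for F G
    using that ordLeq_ordLess_trans[OF card_of_mono1[OF that(2)], of \<kappa>]
    unfolding sets_of_card_less_def by blast
  then have "?P \<subseteq> ?Q \<times> ?Q" by auto
  moreover have "|?Q \<times> ?Q| \<le>o \<mu>"
    using card_of_Times_ordLeq_infinite_Field[OF _ Q Q] m by (auto simp: cinfinite_def)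
  ultimately have "|?P| \<le>o \<mu>" by (rule ordLeq_transitive[OF card_of_mono1])
  moreover have "({}, {}) \<in> ?P"
    using finite_ordLess_infinite[OF card_of_Well_order, of \<kappa> "{} :: 'l set"] assms(1)
    by (auto simp: sets_of_card_less_def Field_card_of cinfinite_def card_order_on_def)
  ultimately obtain p where p: "\<And>\<alpha>. \<alpha> \<in> Field \<mu> \<Longrightarrow> p \<alpha> \<in> ?P"
    "\<And>x. x \<in> ?P \<Longrightarrow> |{\<alpha> \<in> Field \<mu>. p \<alpha> = x}| =o \<mu>"
    using enumeration_with_large_fibres[OF m, of ?P] by blast

  \<comment> \<open>Removing the small set \<open>fst (p \<alpha>)\<close> keeps each
    \<open>R\<close> of size \<kappa>, and the trimmed sets are still fewer than the reaping
    number.\<close>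
  have "\<exists>S. \<forall>R\<in>L \<alpha>. splits S (R - fst (p \<alpha>))" if a: "\<alpha> \<in> Field \<mu>" for \<alpha>
  proof -
    let ?\<R> = "(\<lambda>R. R - fst (p \<alpha>)) ` L \<alpha>"
    have "|fst (p \<alpha>)| <o \<kappa>" using p(1)[OF a] by (auto simp: sets_of_card_less_def)
    then have "?\<R> \<subseteq> sets_of_card ?X \<kappa>"
      using L(1)[OF a] card_Diff_less[OF assms(1)] unfolding sets_of_card_def by blast
    moreover have "|?\<R>| <o reaping_number \<kappa> lam"
      by (rule ordLess_ordIso_trans[OF ordLeq_ordLess_trans[OF card_of_image L(2)[OF a]]
            ordIso_symmetric[OF assms(9)]])
    ultimately obtain S where "\<forall>R \<in> ?\<R>. splits S R"
      by (rule splitting_set_exists) blast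
    then show ?thesis by blast
  qed
  then obtain S where S: "\<And>\<alpha> R. \<alpha> \<in> Field \<mu> \<Longrightarrow> R \<in> L \<alpha> \<Longrightarrow> splits (S \<alpha>) (R - fst (p \<alpha>))"
    by metis
  \<comment> \<open>\<open>S \<alpha>\<close> is altered only inside
    \<open>fst (p \<alpha>)\<close>. This installs the requested trace there and leaves both
    infinite pieces of each trimmed \<open>R\<close> intact.\<close>
  define T where "T \<alpha> = (S \<alpha> - fst (p \<alpha>)) \<union> snd (p \<alpha>)" for \<alpha>
  have T: "splits (T \<alpha>) R" if a: "\<alpha> \<in> Field \<mu>" and R: "R \<in> L \<alpha>" for \<alpha> R
  proof -
    have "snd (p \<alpha>) \<subseteq> fst (p \<alpha>)" using p(1)[OF a] by auto
    then have "(R - fst (p \<alpha>)) \<inter> S \<alpha> \<subseteq> R \<inter> T \<alpha>" "(R - fst (p \<alpha>)) - S \<alpha> \<subseteq> R - T \<alpha>"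
      by (auto simp: T_def)
    then show ?thesis
      using S[OF a R] finite_subset unfolding splits_def by metis
  qed

  have "\<exists>\<I>. barely_independent \<kappa> \<mu> \<I> \<and> |\<I>| =o |?X|"
  proof (rule barely_independent_rows[OF assms(1) m km kX])
    fix F G assume "F \<in> ?Q" "G \<subseteq> F"
    then have "|{\<alpha> \<in> Field \<mu>. p \<alpha> = (F, G)}| =o \<mu>" by (intro p(2)) auto
    moreover have "{\<alpha> \<in> Field \<mu>. p \<alpha> = (F, G)} \<subseteq> {\<alpha> \<in> Field \<mu>. T \<alpha> \<inter> F = G}"
      using \<open>G \<subseteq> F\<close> by (auto simp: T_def)
    ultimately show "\<mu> \<le>o |{\<alpha> \<in> Field \<mu>. T \<alpha> \<inter> F = G}|"
      by (rule ordIso_ordLeq_trans[OF ordIso_symmetric card_of_mono1])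
  next
    fix R assume "R \<in> sets_of_card ?X \<kappa>"
    then have "|{\<alpha> \<in> Field \<mu>. R \<notin> L \<alpha>}| <o \<mu>" by (rule L(3))
    moreover have "{\<alpha> \<in> Field \<mu>. \<not> splits (T \<alpha>) R} \<subseteq> {\<alpha> \<in> Field \<mu>. R \<notin> L \<alpha>}"
      using T by blast
    ultimately show "|{\<alpha> \<in> Field \<mu>. \<not> splits (T \<alpha>) R}| <o \<mu>"
      by (rule ordLeq_ordLess_trans[OF card_of_mono1, rotated])
  qed
  then show ?thesis using ordIso_transitive[OF _ lX] by blast
qed

end
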